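(* Let $G$ be a nice $d$-degenerate graph with maximum degree $\Delta(G)$. Then $G$ is $(1, \Delta(G) + d + 1)$-weight choosable. Alternately, every nice graph $G$ is $(1, \Delta(G) + \mathrm{col}(G))$-weight choosable.
   Context: All graphs are finite, simple and loopless. A graph is nice if it has no connected component isomorphic to $K_2$. A graph is $d$-degenerate if every induced subgraph of it has a vertex of degree (in that subgraph) at most $d$. The degeneracy $\partial(G)$ is the smallest $d$ for which $G$ is $d$-degenerate, and $\mathrm{col}(G) = \partial(G)+1$ is the colouring number of $G$. A graph $G$ is $(k,l)$-weight choosable if for every assignment of a list $L_v$ of $k$ real numbers to each vertex $v$ and a list $L_e$ of $l$ real numbers to each edge $e$, there is a choice of weights $w(v)\in L_v$ and $w(e)\in L_e$ (for all $v \in V(G)$, $e\in E(G)$) such that the function $v\mapsto w(v)+\sum_{e\ni v} w(e)$ is a proper colouring of $V(G)$ (adjacent vertices get different values). *)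

theory Defs
  imports Complex_Main
begin

text \<open>Undirected graphs: an edge is the two-element set of its endpoints.\<close>

datatype 'a graph = Graph (verts: "'a set") (edges: "'a set set")

definition simple_graph :: "'a graph \<Rightarrow> bool" where
  "simple_graph G \<longleftrightarrow> finite (verts G) \<and> (\<forall>e\<in>edges G. e \<subseteq> verts G \<and> card e = 2)"

definition adjacent :: "'a graph \<Rightarrow> 'a \<Rightarrow> 'a \<Rightarrow> bool" where
  "adjacent G u v \<longleftrightarrow> {u, v} \<in> edges G"

definition incident_edges :: "'a graph \<Rightarrow> 'a \<Rightarrow> 'a set set" where
  "incident_edges G v = {e \<in> edges G. v \<in> e}"

definition degree :: "'a graph \<Rightarrow> 'a \<Rightarrow> nat" where
  "degree G v = card (incident_edges G v)"

text \<open>The inserted 0 only matters for the graph without vertices, whose maximum degree is 0.\<close>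

definition max_degree :: "'a graph \<Rightarrow> nat" where
  "max_degree G = Max (insert 0 (degree G ` verts G))"

definition induced :: "'a graph \<Rightarrow> 'a set \<Rightarrow> 'a graph" where
  "induced G S = Graph S {e \<in> edges G. e \<subseteq> S}"

definition component_of :: "'a graph \<Rightarrow> 'a \<Rightarrow> 'a set" where
  "component_of G v = {u \<in> verts G. (adjacent G)\<^sup>*\<^sup>* v u}"

definition components :: "'a graph \<Rightarrow> 'a graph set" where
  "components G = (\<lambda>v. induced G (component_of G v)) ` verts G"

definition isomorphic :: "'a graph \<Rightarrow> 'b graph \<Rightarrow> bool" where
  "isomorphic G H \<longleftrightarrow> (\<exists>f. bij_betw f (verts G) (verts H) \<and>
     (\<forall>u\<in>verts G. \<forall>v\<in>verts G. adjacent G u v \<longleftrightarrow> adjacent H (f u) (f v)))"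

definition complete_graph :: "nat \<Rightarrow> nat graph" where
  "complete_graph n = Graph {..<n} {e. e \<subseteq> {..<n} \<and> card e = 2}"

definition nice :: "'a graph \<Rightarrow> bool" where
  "nice G \<longleftrightarrow> \<not> (\<exists>C\<in>components G. isomorphic C (complete_graph 2))"

text \<open>As usual, only nonempty induced subgraphs are required to have a vertex of small degree.\<close>

definition degenerate :: "nat \<Rightarrow> 'a graph \<Rightarrow> bool" where
  "degenerate d G \<longleftrightarrow>
     (\<forall>S. S \<subseteq> verts G \<and> S \<noteq> {} \<longrightarrow> (\<exists>v\<in>S. degree (induced G S) v \<le> d))"

definition degeneracy :: "'a graph \<Rightarrow> nat" where
  "degeneracy G = (LEAST d. degenerate d G)"

definition col :: "'a graph \<Rightarrow> nat" where
  "col G = degeneracy G + 1"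

definition proper_colouring :: "'a graph \<Rightarrow> ('a \<Rightarrow> 'c) \<Rightarrow> bool" where
  "proper_colouring G c \<longleftrightarrow>
     (\<forall>u\<in>verts G. \<forall>v\<in>verts G. adjacent G u v \<longrightarrow> c u \<noteq> c v)"

text \<open>
  A list of \<open>k\<close> real numbers is a set of \<open>k\<close> distinct reals; finiteness is stated separately
  because \<^const>\<open>card\<close> is 0 on infinite sets.
\<close>

definition list_assignment :: "nat \<Rightarrow> 'b set \<Rightarrow> ('b \<Rightarrow> real set) \<Rightarrow> bool" where
  "list_assignment k A L \<longleftrightarrow> (\<forall>x\<in>A. finite (L x) \<and> card (L x) = k)"

definition weight_choosable :: "nat \<Rightarrow> nat \<Rightarrow> 'a graph \<Rightarrow> bool" where
  "weight_choosable k l G \<longleftrightarrow>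
     (\<forall>LV LE. list_assignment k (verts G) LV \<and> list_assignment l (edges G) LE \<longrightarrow>
       (\<exists>wV wE. (\<forall>v\<in>verts G. wV v \<in> LV v) \<and> (\<forall>e\<in>edges G. wE e \<in> LE e) \<and>
          proper_colouring G (\<lambda>v. wV v + (\<Sum>e\<in>incident_edges G v. wE e))))"

end

(* Fix the edge weights greedily, one edge at a time.  Whether the ends of an edge f get different
   colours is settled by the last processed edge that meets f in exactly one vertex, which exists
   because G is nice; at that moment f forbids at most one value.  Order the edges by repeatedly
   peeling off, to be processed last, an edge at a vertex x of degree at most d in the remaining
   graph.  An edge e = xy then settles at most d(y) - 1 edges at y, at most d - 1 edges at x
   processed before e, and at most one edge at x processed after e: two such edges at x would each
   have a neighbour processed later than e.  So fewer than Delta + d values are forbidden. *)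

theory Submission imports Defs begin

section \<open>Greedy choices along a ranking\<close>

text \<open>Elements of \<open>E\<close> receive their values in order of \<open>r\<close>. A
  constraint \<open>c\<close> is decided when \<open>settle c\<close> is reached, since later
  changes cannot affect \<open>Q c\<close>. At \<open>e\<close>, each constraint settled there rules
  out at most one value, so by \<open>few\<close> some value of \<open>L e\<close> survives.\<close>

lemma greedy_choice:
  fixes r :: "'e \<Rightarrow> nat" and settle :: "'c \<Rightarrow> 'e" and Q :: "'c \<Rightarrow> ('e \<Rightarrow> 'w) \<Rightarrow> bool"
  assumes inj: "inj_on r E" and C: "finite C"
    and settle: "\<And>c. c \<in> C \<Longrightarrow> settle c \<in> E"
    and later: "\<And>c w e x. \<lbrakk>c \<in> C; e \<in> E; r (settle c) < r e\<rbrakk> \<Longrightarrow> Q c (w(e := x)) = Q c w"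
    and one_bad: "\<And>c w x y. \<lbrakk>c \<in> C; \<not> Q c (w(settle c := x)); \<not> Q c (w(settle c := y))\<rbrakk> \<Longrightarrow> x = y"
    and few: "\<And>e. e \<in> E \<Longrightarrow> card {c \<in> C. settle c = e} < card (L e)"
    and E: "finite E"
  shows "\<exists>w. (\<forall>e\<in>E. w e \<in> L e) \<and> (\<forall>c\<in>C. Q c w)"
proof -
  have "\<exists>w. (\<forall>e\<in>E. r e < k \<longrightarrow> w e \<in> L e) \<and> (\<forall>c\<in>C. r (settle c) < k \<longrightarrow> Q c w)" for k
  proof (induction k)
    case 0
    then show ?case by simp
  next
    case (Suc k)
    then obtain w where w: "\<And>e. \<lbrakk>e \<in> E; r e < k\<rbrakk> \<Longrightarrow> w e \<in> L e"
      and Q: "\<And>c. \<lbrakk>c \<in> C; r (settle c) < k\<rbrakk> \<Longrightarrow> Q c w"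
      by blast
    show ?case
    proof (cases "\<exists>e\<in>E. r e = k")
      case False
      then have "\<forall>e\<in>E. r e < Suc k \<longrightarrow> r e < k"
        by (auto simp: less_Suc_eq)
      with w Q settle show ?thesis by (intro exI[of _ w]) blast
    next
      case True
      then obtain e where e: "e \<in> E" "r e = k" by blast
      define D where "D = {c \<in> C. settle c = e}"
      \<comment> \<open>If \<open>c\<close> has no bad value, \<open>bad c\<close> is arbitrary.
        Avoiding it is then unnecessary but harmless, and each constraint still costs one
        value.\<close>
      define bad where "bad c = (SOME x. \<not> Q c (w(e := x)))" for c
      have bad: "Q c (w(e := x))" if "c \<in> D" "x \<noteq> bad c" for c x
      proof (rule ccontr)
        assume *: "\<not> Q c (w(e := x))"
        then have "\<not> Q c (w(e := bad c))"
          unfolding bad_def by (rule someI)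
        with * one_bad[of c w x "bad c"] that show False by (auto simp: D_def)
      qed
      have "finite D" using C by (simp add: D_def)
      then have "card (bad ` D) < card (L e)"
        using card_image_le[of D bad] few[OF e(1)] by (simp add: D_def)
      then have "\<not> L e \<subseteq> bad ` D"
        using card_mono[of "bad ` D" "L e"] \<open>finite D\<close> by auto
      then obtain x where x: "x \<in> L e" "x \<notin> bad ` D" by blast
      have "(w(e := x)) f \<in> L f" if "f \<in> E" "r f < Suc k" for f
        using that inj e w x(1) by (auto simp: less_Suc_eq dest: inj_onD)
      moreover have "Q c (w(e := x))" if "c \<in> C" "r (settle c) < Suc k" for c
      proof (cases "settle c = e")
        case True
        then show ?thesis using bad x(2) that by (auto simp: D_def)
      next
        case False
        then have "r (settle c) < k"
          using that e inj settle by (auto simp: less_Suc_eq dest: inj_onD)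
        then show ?thesis using later[of c e] Q that e by simp
      qed
      ultimately show ?thesis by blast
    qed
  qed
  \<comment> \<open>This bound exceeds every rank, so nothing remains to be processed.\<close>
  from this[of "Suc (Max (r ` E))"] obtain w
    where w: "\<forall>e\<in>E. r e < Suc (Max (r ` E)) \<longrightarrow> w e \<in> L e"
      "\<forall>c\<in>C. r (settle c) < Suc (Max (r ` E)) \<longrightarrow> Q c w"
    by blast
  have "r e < Suc (Max (r ` E))" if "e \<in> E" for e
    using that E by (simp add: less_Suc_eq_le)
  with w settle show ?thesis by blast
qed

text \<open>Peel off an element that is good for the whole set, give it the top rank and recurse on
  the rest. When an element is removed, the set still present is exactly the set of elements ranked
  no higher than it.\<close>

lemma peeling_rank:
  assumes "finite E"
    and "\<And>F. \<lbrakk>F \<subseteq> E; F \<noteq> {}\<rbrakk> \<Longrightarrow> \<exists>e\<in>F. P e F"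
  shows "\<exists>r :: 'e \<Rightarrow> nat. inj_on r E \<and> (\<forall>e\<in>E. P e {f \<in> E. r f \<le> r e})"
  using assms
proof (induction E rule: finite_psubset_induct)
  case (psubset E)
  show ?case
  proof (cases "E = {}")
    case False
    then obtain e where e: "e \<in> E" "P e E" using psubset.prems[of E] by blast
    have "\<exists>r :: 'e \<Rightarrow> nat. inj_on r (E - {e}) \<and> (\<forall>g\<in>E - {e}. P g {f \<in> E - {e}. r f \<le> r g})"
    proof (rule psubset.IH)
      show "E - {e} \<subset> E" using e by blast
      show "\<exists>g\<in>F. P g F" if "F \<subseteq> E - {e}" "F \<noteq> {}" for F
        using that by (intro psubset.prems) auto
    qed
    then obtain r :: "'e \<Rightarrow> nat" where r: "inj_on r (E - {e})"
      "\<And>g. g \<in> E - {e} \<Longrightarrow> P g {f \<in> E - {e}. r f \<le> r g}" by blast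
    define r' where "r' = r(e := Suc (Max (r ` E)))"
    have lt: "r' f < r' e" if "f \<in> E" "f \<noteq> e" for f
      using that psubset.hyps by (simp add: r'_def less_Suc_eq_le)
    have "inj_on r' E"
    proof (rule inj_onI)
      fix f g assume "f \<in> E" "g \<in> E" "r' f = r' g"
      then show "f = g"
        using lt[of f] lt[of g] inj_onD[OF r(1), of f g] by (cases "f = e"; cases "g = e") (auto simp: r'_def)
    qed
    moreover have "P g {f \<in> E. r' f \<le> r' g}" if "g \<in> E" for g
    proof (cases "g = e")
      case True
      then have "{f \<in> E. r' f \<le> r' g} = E" using lt by force
      with e True show ?thesis by simp
    next
      case False
      then have "{f \<in> E. r' f \<le> r' g} = {f \<in> E - {e}. r f \<le> r g}"
        using lt[of g] that by (auto simp: r'_def)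
      with r(2)[of g] that False show ?thesis by simp
    qed
    ultimately show ?thesis by blast
  qed simp
qed

section \<open>Consequences of niceness and degeneracy for edges\<close>

lemma finite_edges: "simple_graph G \<Longrightarrow> finite (edges G)"
  unfolding simple_graph_def by (rule finite_subset[of _ "Pow (verts G)"]) auto

lemma degree_le_max_degree:
  assumes "simple_graph G" "v \<in> verts G"
  shows "degree G v \<le> max_degree G"
  using assms unfolding max_degree_def simple_graph_def by (intro Max_ge) auto

text \<open>If no other edge met \<open>f\<close>, no path could leave \<open>f\<close>, so
  \<open>f\<close> would span a component isomorphic to K2. The lemma guarantees that every edge has
  a candidate for settling it.\<close>

lemma nice_edge_adjacent_edge:
  assumes G: "simple_graph G" "nice G" and f: "f \<in> edges G"
  shows "\<exists>g\<in>edges G. g \<noteq> f \<and> g \<inter> f \<noteq> {}"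
proof (rule ccontr)
  assume isolated: "\<not> ?thesis"
  obtain u v where uv: "f = {u, v}" "u \<noteq> v" "f \<subseteq> verts G"
    using G f by (auto simp: simple_graph_def card_2_iff)
  have reach: "x = u \<or> x = v" if "(adjacent G)\<^sup>*\<^sup>* u x" for x
    using that
  proof (induction rule: rtranclp_induct)
    case (step y z)
    then have "{y, z} \<in> edges G" "{y, z} \<inter> f \<noteq> {}"
      using uv(1) by (auto simp: adjacent_def)
    with isolated have "f = {y, z}" by metis
    then have "z \<in> f" by simp
    with uv(1) show ?case by simp
  qed simp
  have "adjacent G u v" using f uv by (simp add: adjacent_def)
  then have comp: "component_of G u = f"
    using reach uv(1,3) by (auto simp: component_of_def)
  have *: "{a, b} \<in> edges G \<longleftrightarrow> a \<noteq> b" if "a \<in> f" "b \<in> f" for a b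
  proof
    assume "{a, b} \<in> edges G"
    then have "card {a, b} = 2" using G by (simp add: simple_graph_def)
    then show "a \<noteq> b" by auto
  next
    assume "a \<noteq> b"
    with that uv(1) have "{a, b} = f" by auto
    with f show "{a, b} \<in> edges G" by simp
  qed
  have "isomorphic (induced G f) (complete_graph 2)"
    unfolding isomorphic_def
  proof (intro exI[of _ "\<lambda>x. if x = u then 0 else 1"] conjI)
    show "bij_betw (\<lambda>x. if x = u then 0 else 1) (verts (induced G f)) (verts (complete_graph 2))"
      using uv by (auto simp: bij_betw_def induced_def complete_graph_def)
    show "\<forall>a\<in>verts (induced G f). \<forall>b\<in>verts (induced G f).
        adjacent (induced G f) a b \<longleftrightarrow>
        adjacent (complete_graph 2) (if a = u then 0 else 1) (if b = u then 0 else 1)"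
      using uv by (auto simp: induced_def complete_graph_def adjacent_def *)
  qed
  moreover have "induced G f \<in> components G"
    using comp uv unfolding components_def by (metis image_eqI insert_subset)
  ultimately show False using G(2) by (auto simp: nice_def)
qed

text \<open>Degeneracy is applied to the subgraph induced on the ends of \<open>F\<close>. It
  contains all of \<open>F\<close>, so its degree at \<open>x\<close> bounds the number of edges of
  \<open>F\<close> at \<open>x\<close>, and \<open>x\<close> lies on some edge of \<open>F\<close>
  by the choice of vertex set. This supplies the peeling condition.\<close>

lemma degenerate_edge_subset:
  assumes G: "simple_graph G" and d: "degenerate d G" and F: "F \<subseteq> edges G" "F \<noteq> {}"
  shows "\<exists>e\<in>F. \<exists>x\<in>e. card {f \<in> F. x \<in> f} \<le> d"
proof -
  have "\<Union>F \<subseteq> verts G" using G F by (auto simp: simple_graph_def)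
  moreover have "\<Union>F \<noteq> {}" using G F by (fastforce simp: simple_graph_def)
  ultimately obtain x where x: "x \<in> \<Union>F" "degree (induced G (\<Union>F)) x \<le> d"
    using d unfolding degenerate_def by blast
  have "card {f \<in> F. x \<in> f} \<le> degree (induced G (\<Union>F)) x"
    unfolding degree_def
    using finite_edges[OF G] F by (intro card_mono) (auto simp: incident_edges_def induced_def)
  with x show ?thesis by force
qed

lemma edge_weight_sum_upd:
  assumes "simple_graph G" "g \<in> edges G"
  shows "(\<Sum>e\<in>incident_edges G v. (w(g := x)) e) =
    (\<Sum>e\<in>incident_edges G v. w e) + (if v \<in> g then x - w g else (0::real))"
proof -
  have fin: "finite (incident_edges G v)"
    using finite_edges[OF assms(1)] by (simp add: incident_edges_def)
  have "(\<Sum>e\<in>incident_edges G v. (w(g := x)) e) =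
    (\<Sum>e\<in>incident_edges G v. w e + (if e = g then x - w g else 0))"
    by (intro sum.cong) auto
  also have "\<dots> = (\<Sum>e\<in>incident_edges G v. w e) + (if g \<in> incident_edges G v then x - w g else 0)"
    using fin by (simp add: sum.distrib)
  finally show ?thesis using assms(2) by (simp add: incident_edges_def)
qed

section \<open>Counting settled edges and choosing the weights\<close>

lemma degenerate_weight_choosable:
  assumes G: "simple_graph G" and nice: "nice G" and d: "degenerate d G"
  shows "weight_choosable 1 (max_degree G + d + 1) G"
proof -
  let ?E = "edges G"
  let ?P = "\<lambda>e F. \<exists>x\<in>e. card {f \<in> F. x \<in> f} \<le> d"
  have E: "finite ?E" using G by (rule finite_edges)
  have two: "card e = 2" "e \<subseteq> verts G" if "e \<in> ?E" for e
    using G that by (auto simp: simple_graph_def)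
  obtain r :: "'a set \<Rightarrow> nat" where inj: "inj_on r ?E"
    and r: "\<And>e. e \<in> ?E \<Longrightarrow> \<exists>x\<in>e. card {f \<in> {f \<in> ?E. r f \<le> r e}. x \<in> f} \<le> d"
    using peeling_rank[of ?E ?P] E degenerate_edge_subset[OF G d] by blast
  \<comment> \<open>Since edges are two-element sets, these are the edges meeting \<open>f\<close>
    in exactly one vertex.\<close>
  define N where "N f = {g \<in> ?E. g \<noteq> f \<and> g \<inter> f \<noteq> {}}" for f
  have "\<exists>g. g \<in> N f \<and> (\<forall>h\<in>N f. r h \<le> r g)" if "f \<in> ?E" for f
  proof -
    have "finite (N f)" "N f \<noteq> {}"
      using E nice_edge_adjacent_edge[OF G nice that] by (auto simp: N_def)
    then have "Max (r ` N f) \<in> r ` N f" by (intro Max_in) auto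
    then obtain g where "g \<in> N f" "Max (r ` N f) = r g" by blast
    with \<open>finite (N f)\<close> show ?thesis by (metis Max_ge finite_imageI imageI)
  qed
  then obtain settle where settle: "\<And>f. f \<in> ?E \<Longrightarrow> settle f \<in> N f"
    and settle_max: "\<And>f h. \<lbrakk>f \<in> ?E; h \<in> N f\<rbrakk> \<Longrightarrow> r h \<le> r (settle f)"
    by metis
  have few: "card {f \<in> ?E. settle f = e} < max_degree G + d + 1" if e: "e \<in> ?E" for e
  proof -
    obtain x where x: "x \<in> e" "card {f \<in> {f \<in> ?E. r f \<le> r e}. x \<in> f} \<le> d"
      using r[OF e] by blast
    obtain y where y: "e = {x, y}" "x \<noteq> y"
      using two(1)[OF e] x(1) by (metis card_2_iff doubleton_eq_iff insert_iff singletonD)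
    define A where "A = incident_edges G y"
    define B where "B = {f \<in> {f \<in> ?E. r f \<le> r e}. x \<in> f}"
    define C where "C = {f \<in> ?E. settle f = e \<and> x \<in> f \<and> r e < r f}"
    have fin: "finite A" "finite B" "finite C"
      using E by (auto simp: A_def B_def C_def incident_edges_def)
    have "card A \<le> max_degree G"
      using degree_le_max_degree[OF G, of y] two(2)[OF e] y by (simp add: A_def degree_def)
    moreover have "card B \<le> d" using x(2) by (simp add: B_def)
    \<comment> \<open>Discarding \<open>e\<close>, which never settles itself, makes the bound
      strict and so leaves room for the single possible member of \<open>C\<close>.\<close>
    moreover have "card (A \<union> B - {e}) < card (A \<union> B)"
      using fin e y by (intro psubset_card_mono) (auto simp: B_def)
    ultimately have AB: "card (A \<union> B - {e}) < max_degree G + d"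
      using card_Un_le[of A B] by linarith
    \<comment> \<open>Two distinct members share \<open>x\<close>, so each lies in the other's
      \<open>N\<close>. Then \<open>settle f\<close>, which is \<open>e\<close>, would have rank at
      least that of \<open>g\<close>, contrary to \<open>r e < r g\<close>.\<close>
    have "f = g" if "f \<in> C" "g \<in> C" for f g
    proof (rule ccontr)
      assume "f \<noteq> g"
      with that have "g \<in> N f" by (auto simp: C_def N_def)
      with that settle_max[of f g] show False by (auto simp: C_def)
    qed
    then have "card C \<le> 1" by (simp add: card_le_Suc0_iff_eq fin)
    \<comment> \<open>An edge settled by \<open>e\<close> meets it at \<open>y\<close> (in
      \<open>A\<close>) or at \<open>x\<close>, where its rank decides between \<open>B\<close> and
      \<open>C\<close>.\<close>
    moreover have "{f \<in> ?E. settle f = e} \<subseteq> (A \<union> B - {e}) \<union> C"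
      using settle y unfolding A_def B_def C_def N_def incident_edges_def by fastforce
    then have "card {f \<in> ?E. settle f = e} \<le> card ((A \<union> B - {e}) \<union> C)"
      using fin by (intro card_mono) auto
    ultimately show ?thesis
      using AB card_Un_le[of "A \<union> B - {e}" C] by linarith
  qed
  show ?thesis
    unfolding weight_choosable_def
  proof (intro allI impI)
    fix LV :: "'a \<Rightarrow> real set" and LE :: "'a set \<Rightarrow> real set"
    assume L: "list_assignment 1 (verts G) LV \<and> list_assignment (max_degree G + d + 1) ?E LE"
    then have "\<forall>v\<in>verts G. \<exists>x. x \<in> LV v"
      by (auto simp: list_assignment_def card_1_singleton_iff)
    then obtain wV where wV: "\<And>v. v \<in> verts G \<Longrightarrow> wV v \<in> LV v" by metis
    define c where "c w v = wV v + (\<Sum>e\<in>incident_edges G v. w e)" for w :: "'a set \<Rightarrow> real" and v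
    have upd: "c (w(g := x)) v = c w v + (if v \<in> g then x - w g else 0)" if "g \<in> ?E" for w g x v
      unfolding c_def edge_weight_sum_upd[OF G that] by simp
    \<comment> \<open>The constraints are indexed by the edges: \<open>f\<close> demands that its
      two ends get different colours, stated as injectivity on \<open>f\<close>.\<close>
    have "\<exists>w. (\<forall>e\<in>?E. w e \<in> LE e) \<and> (\<forall>f\<in>?E. inj_on (c w) f)"
    proof (rule greedy_choice[OF inj E, of settle])
      show "settle f \<in> ?E" if "f \<in> ?E" for f
        using settle[OF that] by (simp add: N_def)
      \<comment> \<open>An edge ranked above \<open>settle f\<close> is either disjoint from
        \<open>f\<close>, leaving both end colours alone, or \<open>f\<close> itself, shifting both
        by the same amount.\<close>
      show "inj_on (c (w(e := x))) f = inj_on (c w) f"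
        if "f \<in> ?E" "e \<in> ?E" "r (settle f) < r e" for f e w x
      proof -
        from that settle_max[of f e] have "e \<notin> N f" by auto
        with that have "e = f \<or> e \<inter> f = {}" by (auto simp: N_def)
        then show ?thesis
          by (auto simp: inj_on_def upd[OF that(2)])
      qed
      show "x = y" if f: "f \<in> ?E" and bad: "\<not> inj_on (c (w(settle f := x))) f"
        "\<not> inj_on (c (w(settle f := y))) f" for f w x y
      proof -
        let ?g = "settle f"
        have g: "?g \<in> ?E" "?g \<noteq> f" "?g \<inter> f \<noteq> {}" using settle[OF f] by (auto simp: N_def)
        then obtain u where u: "u \<in> f" "u \<in> ?g" by blast
        obtain v where v: "f = {u, v}" "u \<noteq> v"
          using two(1)[OF f] u(1) by (metis card_2_iff doubleton_eq_iff insert_iff singletonD)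
        have "v \<notin> ?g"
        proof
          assume "v \<in> ?g"
          with u v have "f \<subseteq> ?g" by simp
          moreover have "finite ?g" using two(1)[OF g(1)] by (simp add: card_ge_0_finite)
          ultimately show False using two(1) f g by (metis card_subset_eq)
        qed
        \<comment> \<open>Only the colour of \<open>u\<close> depends on the weight
          \<open>z\<close>, with slope 1, so it equals the fixed colour of \<open>v\<close> for just
          one \<open>z\<close>.\<close>
        then have "c (w(?g := z)) u = c w u + (z - w ?g)" "c (w(?g := z)) v = c w v" for z
          using u(2) by (simp_all add: upd[OF g(1)])
        moreover have "c w' u = c w' v" if "\<not> inj_on (c w') f" for w'
          using that unfolding v(1) inj_on_def by force
        ultimately have "c w u + (x - w ?g) = c w v" "c w u + (y - w ?g) = c w v"
          using bad by metis+
        then show ?thesis by simp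
      qed
      show "card {f \<in> ?E. settle f = e} < card (LE e)" if "e \<in> ?E" for e
        using few[OF that] L that by (simp add: list_assignment_def)
    qed (rule E)
    then obtain w where w: "\<forall>e\<in>?E. w e \<in> LE e" "\<And>f. f \<in> ?E \<Longrightarrow> inj_on (c w) f" by blast
    have "c w u \<noteq> c w v" if "adjacent G u v" for u v
    proof -
      have "{u, v} \<in> ?E" using that by (simp add: adjacent_def)
      with w(2)[of "{u, v}"] two(1)[of "{u, v}"] show ?thesis by (auto simp: card_2_iff)
    qed
    then have "proper_colouring G (\<lambda>v. wV v + (\<Sum>e\<in>incident_edges G v. w e))"
      by (simp add: proper_colouring_def c_def)
    with wV w(1) show "\<exists>wV wE. (\<forall>v\<in>verts G. wV v \<in> LV v) \<and> (\<forall>e\<in>?E. wE e \<in> LE e) \<and>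
        proper_colouring G (\<lambda>v. wV v + (\<Sum>e\<in>incident_edges G v. wE e))"
      by blast
  qed
qed

text \<open>The least value is attained because some value works: the number of edges bounds every
  degree in every induced subgraph. The colouring number form of the theorem is the resulting
  instance.\<close>

lemma degenerate_degeneracy:
  assumes "simple_graph G"
  shows "degenerate (degeneracy G) G"
  unfolding degeneracy_def
proof (rule LeastI)
  have "degree (induced G S) v \<le> card (edges G)" for S v
    unfolding degree_def using finite_edges[OF assms]
    by (intro card_mono) (auto simp: incident_edges_def induced_def)
  then show "degenerate (card (edges G)) G" by (auto simp: degenerate_def)
qed

theorem corollary4p4:
  fixes G :: "'a graph"
  assumes "simple_graph G" and "nice G"
  shows "(\<forall>d. degenerate d G \<longrightarrow> weight_choosable 1 (max_degree G + d + 1) G) \<and>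
         weight_choosable 1 (max_degree G + col G) G"
  using degenerate_weight_choosable[OF assms] degenerate_degeneracy[OF assms(1)]
  by (simp add: col_def flip: add.assoc)

end
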